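(* Let $\sigma\neq 0$, $T_f>0$, $B_{max}>0$ and $\delta\in(0,1)$ be given real numbers. For real $N\ge 0$ and $\alpha\in[0,1]$ let $$f(N,\alpha):=e^{-\frac{N^2B_{max}^2(1-\alpha)^2}{2\sigma^2T_f}}+e^{-\frac{N^2B_{max}^2\alpha^2}{2\sigma^2T_f}}.$$ For $\alpha\in(0,1)$ let $$N(\alpha):=\min\{N\in\mathbb{R}: N\ge 0,\ f(N,\alpha)\le\delta\},$$ and let $$\tilde N:=\min\{N\in\mathbb{R}: N\ge 0 \text{ and there is } \alpha\in(0,1) \text{ with } f(N,\alpha)\le\delta\}=\min_{\alpha\in(0,1)}N(\alpha).$$ Set $$N_o:=\frac{\sqrt{8\sigma^2T_f\ln(2/\delta)}}{B_{max}}.$$ Then $N(\tfrac12)=N_o$. Further, $N(\tfrac12)\le N(\alpha)$ for all $\alpha\in(0,1)\setminus\{\tfrac12\}$. Thus $\tilde N=N(\tfrac12)=N_o$.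
   Context: The number $N$ (of battery units, each with maximum capacity $B_{max}$) is treated as a nonnegative real variable; $\alpha$ is the ratio of the initial charge to the maximum charge. *)

theory Defs
  imports Complex_Main
begin

definition f :: "real \<Rightarrow> real \<Rightarrow> real \<Rightarrow> real \<Rightarrow> real \<Rightarrow> real" where
  "f \<sigma> T\<^sub>f B N \<alpha> =
     exp (- (N\<^sup>2 * B\<^sup>2 * (1 - \<alpha>)\<^sup>2 / (2 * \<sigma>\<^sup>2 * T\<^sub>f)))
     + exp (- (N\<^sup>2 * B\<^sup>2 * \<alpha>\<^sup>2 / (2 * \<sigma>\<^sup>2 * T\<^sub>f)))"

definition is_minimum :: "real set \<Rightarrow> real \<Rightarrow> bool" where
  "is_minimum S m \<longleftrightarrow> m \<in> S \<and> (\<forall>x\<in>S. m \<le> x)"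

definition feasible :: "real \<Rightarrow> real \<Rightarrow> real \<Rightarrow> real \<Rightarrow> real \<Rightarrow> real set" where
  "feasible \<sigma> T\<^sub>f B \<delta> \<alpha> = {N. 0 \<le> N \<and> f \<sigma> T\<^sub>f B N \<alpha> \<le> \<delta>}"

definition feasible_any :: "real \<Rightarrow> real \<Rightarrow> real \<Rightarrow> real \<Rightarrow> real set" where
  "feasible_any \<sigma> T\<^sub>f B \<delta> = {N. 0 \<le> N \<and> (\<exists>\<alpha>\<in>{0<..<1}. f \<sigma> T\<^sub>f B N \<alpha> \<le> \<delta>)}"

text \<open>
  \<open>LEAST\<close> denotes an unspecified real if the set has no minimum, so \<open>N_of\<close> and \<open>N_tilde\<close> are
  meaningful only together with \<open>is_minimum\<close> facts that the minima are attained.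
\<close>

definition N_of :: "real \<Rightarrow> real \<Rightarrow> real \<Rightarrow> real \<Rightarrow> real \<Rightarrow> real" where
  "N_of \<sigma> T\<^sub>f B \<delta> \<alpha> = (LEAST N. N \<in> feasible \<sigma> T\<^sub>f B \<delta> \<alpha>)"

definition N_tilde :: "real \<Rightarrow> real \<Rightarrow> real \<Rightarrow> real \<Rightarrow> real" where
  "N_tilde \<sigma> T\<^sub>f B \<delta> = (LEAST N. N \<in> feasible_any \<sigma> T\<^sub>f B \<delta>)"

definition N_o :: "real \<Rightarrow> real \<Rightarrow> real \<Rightarrow> real \<Rightarrow> real" where
  "N_o \<sigma> T\<^sub>f B \<delta> = sqrt (8 * \<sigma>\<^sup>2 * T\<^sub>f * ln (2 / \<delta>)) / B"

end

theory Submission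
  imports Defs "HOL-Analysis.Elementary_Metric_Spaces"
begin

text \<open>
  With \<open>c = N\<^sup>2 B\<^sup>2 / (2 \<sigma>\<^sup>2 T\<^sub>f)\<close> and \<open>\<alpha> = 1/2 - x\<close>, the function equals
  \<open>2 exp (-c/4) exp (-c x\<^sup>2) cosh (c x)\<close>. It is not true for small \<open>c\<close> that \<open>\<alpha> = 1/2\<close> minimises it,
  but for \<open>c \<ge> 4 ln 2\<close> it is: \<open>ln (cosh y) / y\<^sup>2\<close> decreases in \<open>y > 0\<close>, so
  \<open>cosh (c x) \<ge> exp (c x\<^sup>2)\<close> only has to be checked at \<open>x = 1/2\<close>. For \<open>c \<le> 4 ln 2\<close> the function is at
  least its value at \<open>c = 4 ln 2\<close>, hence at least \<open>1 > \<delta>\<close>, so such \<open>c\<close> are never feasible.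
\<close>

section \<open>Inequalities for hyperbolic functions\<close>

lemma le_sinh_real:
  fixes y :: real
  assumes "0 \<le> y"
  shows "y \<le> sinh y"
proof -
  have "(\<lambda>y. sinh y - y) 0 \<le> (\<lambda>y. sinh y - y) y"
  proof (rule DERIV_nonneg_imp_nondecreasing[OF assms])
    fix z :: real
    show "\<exists>D. ((\<lambda>y. sinh y - y) has_real_derivative D) (at z) \<and> 0 \<le> D"
      by (rule exI[of _ "cosh z - 1"]) (auto intro!: derivative_eq_intros simp: cosh_real_ge_1)
  qed
  then show ?thesis by simp
qed

text \<open>Up to a positive factor, the difference of the two sides is the derivative of
  \<open>ln (cosh y) / y\<^sup>2\<close>. It vanishes at 0, and its own derivative has the sign of
  \<open>z - sinh z * cosh z\<close>, which is nonpositive because z \<le> sinh z and 1 \<le> cosh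
  z.\<close>

lemma mult_sinh_le_ln_cosh:
  fixes y :: real
  assumes "0 \<le> y"
  shows "y * (sinh y / cosh y) \<le> 2 * ln (cosh y)"
proof -
  let ?g = "\<lambda>y::real. y * (sinh y / cosh y) - 2 * ln (cosh y)"
  have "?g y \<le> ?g 0"
  proof (rule DERIV_nonpos_imp_nonincreasing[OF assms])
    fix z :: real
    assume z: "0 \<le> z"
    have c: "cosh z > 0" by simp
    have "z \<le> sinh z * cosh z"
      using le_sinh_real[OF z] mult_left_mono[OF cosh_real_ge_1[of z], of "sinh z"] z by simp
    moreover have "(?g has_real_derivative (z - sinh z * cosh z) / (cosh z)\<^sup>2) (at z)"
    proof -
      have "(?g has_real_derivative
          sinh z / cosh z + z * ((cosh z * cosh z - sinh z * sinh z) / (cosh z * cosh z))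
            - 2 * (sinh z / cosh z)) (at z)"
        using c by (auto intro!: derivative_eq_intros simp: field_simps)
      moreover have "cosh z * cosh z - sinh z * sinh z = 1"
        using hyperbolic_pythagoras[of z] by (simp add: power2_eq_square)
      moreover have "sinh z / cosh z + z * (1 / (cosh z * cosh z)) - 2 * (sinh z / cosh z)
          = (z - sinh z * cosh z) / (cosh z)\<^sup>2"
        using c by (simp add: field_simps power2_eq_square)
      ultimately show ?thesis by simp
    qed
    ultimately show "\<exists>D. (?g has_real_derivative D) (at z) \<and> D \<le> 0"
      by (metis diff_le_0_iff_le divide_nonpos_nonneg zero_le_power2)
  qed
  then show ?thesis by simp
qed

lemma ln_cosh_div_square_antimono:
  fixes y z :: real
  assumes "0 < y" "y \<le> z"
  shows "ln (cosh z) / z\<^sup>2 \<le> ln (cosh y) / y\<^sup>2"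
proof (rule DERIV_nonpos_imp_nonincreasing[OF \<open>y \<le> z\<close>])
  fix x :: real
  assume "y \<le> x"
  with \<open>0 < y\<close> have x: "0 < x" by simp
  have "((\<lambda>x. ln (cosh x) / x\<^sup>2) has_real_derivative
      (sinh x / cosh x * x\<^sup>2 - ln (cosh x) * (2 * x)) / (x\<^sup>2 * x\<^sup>2)) (at x)"
    using x by (auto intro!: derivative_eq_intros)
  moreover have "sinh x / cosh x * x\<^sup>2 - ln (cosh x) * (2 * x)
      = x * (x * (sinh x / cosh x) - 2 * ln (cosh x))"
    by (simp add: algebra_simps power2_eq_square)
  moreover have "x * (x * (sinh x / cosh x) - 2 * ln (cosh x)) \<le> 0"
    using x mult_sinh_le_ln_cosh[of x] by (intro mult_nonneg_nonpos) auto
  ultimately show "\<exists>D. ((\<lambda>x. ln (cosh x) / x\<^sup>2) has_real_derivative D) (at x) \<and> D \<le> 0"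
    by (metis divide_nonpos_nonneg zero_le_square)
qed

text \<open>After taking logarithms and setting y = c |x|, the claim for nonzero x reads
  \<open>1 / c \<le> ln (cosh y) / y\<^sup>2\<close>. Since y \<le> c/2 and the right side is
  antitone, the endpoint y = c/2 decides.\<close>

lemma exp_square_le_cosh:
  fixes c x :: real
  assumes c: "4 * ln 2 \<le> c" and x: "\<bar>x\<bar> \<le> 1/2"
  shows "exp (c * x\<^sup>2) \<le> cosh (c * x)"
proof (cases "x = 0")
  case True
  then show ?thesis by simp
next
  case False
  have "0 < ln (2::real)" by simp
  with c have c0: "0 < c" by linarith
  let ?y = "c * \<bar>x\<bar>"
  have y: "0 < ?y" "?y \<le> c / 2"
    using False x c0 mult_left_mono[of "\<bar>x\<bar>" "1/2" c] by auto
  \<comment> \<open>The endpoint inequality is u \<le> cosh (c/2). The hypothesis on c says exactly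
    that 2 \<le> u, so 2 u \<le> u * u = exp (c/2), and this is at most 2 cosh (c/2).\<close>
  define u where "u = exp (c / 4)"
  have "exp (ln (2::real)) \<le> u"
    unfolding u_def using c by (subst exp_le_cancel_iff) simp
  then have u: "2 \<le> u" by simp
  have "exp (c / 2) = u * u"
    unfolding u_def by (simp flip: exp_add)
  then have "2 * u \<le> exp (c / 2)"
    using u by (simp add: mult_right_mono)
  also have "\<dots> \<le> 2 * cosh (c / 2)"
    by (simp add: cosh_def)
  finally have "ln u \<le> ln (cosh (c / 2))"
    using u by (subst ln_le_cancel_iff) auto
  then have "c / 4 \<le> ln (cosh (c / 2))"
    by (simp add: u_def)
  then have "(c / 4) / (c / 2)\<^sup>2 \<le> ln (cosh (c / 2)) / (c / 2)\<^sup>2"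
    by (rule divide_right_mono) simp
  also have "\<dots> \<le> ln (cosh ?y) / ?y\<^sup>2"
    by (rule ln_cosh_div_square_antimono[OF y])
  also have "(c / 4) / (c / 2)\<^sup>2 = 1 / c"
    using c0 by (simp add: field_simps power2_eq_square)
  finally have "1 / c * ?y\<^sup>2 \<le> ln (cosh ?y)"
    using y by (subst (asm) pos_le_divide_eq) (simp_all only: zero_less_power)
  moreover have "1 / c * ?y\<^sup>2 = c * x\<^sup>2"
    using c0 by (simp add: field_simps power2_eq_square)
  moreover have "cosh ?y = cosh (c * x)"
    using cosh_real_abs[of "c * x"] c0 by (simp add: abs_mult)
  ultimately have "c * x\<^sup>2 \<le> ln (cosh (c * x))"
    by simp
  then show ?thesis by (simp add: ln_ge_iff)
qed

section \<open>Lower bounds for the sum of two Gaussians\<close>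

lemma gaussian_sum_ge_midpoint:
  fixes c a :: real
  assumes c: "4 * ln 2 \<le> c" and a: "0 \<le> a" "a \<le> 1"
  shows "2 * exp (- (c / 4)) \<le> exp (- (c * (1 - a)\<^sup>2)) + exp (- (c * a\<^sup>2))"
proof -
  define x where "x = 1/2 - a"
  have x: "\<bar>x\<bar> \<le> 1/2"
    using a unfolding x_def by linarith
  \<comment> \<open>The squares of 1 - a = 1/2 + x and a = 1/2 - x share the terms
    \<open>1/4 + x\<^sup>2\<close> and differ only in the sign of x, which leaves a cosh after
    factoring.\<close>
  have "exp (- (c * (1 - a)\<^sup>2)) + exp (- (c * a\<^sup>2))
      = exp (- (c / 4) - c * x\<^sup>2) * (2 * cosh (c * x))"
    unfolding cosh_def x_def
    by (simp add: distrib_left power2_eq_square algebra_simps flip: exp_add)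
  also have "\<dots> \<ge> exp (- (c / 4) - c * x\<^sup>2) * (2 * exp (c * x\<^sup>2))"
    using exp_square_le_cosh[OF c x] by (intro mult_left_mono) auto
  also have "exp (- (c / 4) - c * x\<^sup>2) * (2 * exp (c * x\<^sup>2)) = 2 * exp (- (c / 4))"
    by (simp add: exp_diff)
  finally show ?thesis .
qed

lemma gaussian_sum_le_imp:
  fixes c a \<delta> :: real
  assumes a: "0 \<le> a" "a \<le> 1" and \<delta>: "0 < \<delta>" "\<delta> < 1"
    and le: "exp (- (c * (1 - a)\<^sup>2)) + exp (- (c * a\<^sup>2)) \<le> \<delta>"
  shows "4 * ln (2 / \<delta>) \<le> c"
proof (cases "4 * ln 2 \<le> c")
  case True
  have "exp (- (c / 4)) \<le> \<delta> / 2"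
    using gaussian_sum_ge_midpoint[OF True a] le by simp
  then have "- (c / 4) \<le> ln (\<delta> / 2)"
    using \<delta> by (simp add: ln_ge_iff)
  then show ?thesis
    using \<delta> by (simp add: ln_div)
next
  case False
  \<comment> \<open>This case is contradictory: the sum is antitone in c, and at the threshold the
    midpoint bound is already 1, above \<delta>.\<close>
  define c' :: real where "c' = 4 * ln 2"
  have "exp (- (c' / 4)) = 1 / 2"
    by (simp add: c'_def exp_minus)
  then have "1 \<le> exp (- (c' * (1 - a)\<^sup>2)) + exp (- (c' * a\<^sup>2))"
    using gaussian_sum_ge_midpoint[of c' a] a by (simp add: c'_def)
  also have "\<dots> \<le> exp (- (c * (1 - a)\<^sup>2)) + exp (- (c * a\<^sup>2))"
    using False by (intro add_mono) (auto simp: c'_def intro!: mult_right_mono)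
  finally show ?thesis
    using le \<delta> by simp
qed

section \<open>Attained minima and the value \<open>N_o\<close>\<close>

lemma is_minimum_Least:
  assumes "is_minimum S m"
  shows "(LEAST x. x \<in> S) = m"
  using assms unfolding is_minimum_def by (intro Least_equality) auto

lemma f_half:
  "f \<sigma> T B N (1/2) = 2 * exp (- (N\<^sup>2 * B\<^sup>2 / (8 * \<sigma>\<^sup>2 * T)))"
  by (simp add: f_def power2_eq_square)

context
  fixes \<sigma> T B \<delta> :: real
  assumes \<sigma>: "\<sigma> \<noteq> 0" and T: "T > 0" and B: "B > 0" and \<delta>: "0 < \<delta>" "\<delta> < 1"
begin

lemma N_o_nonneg: "0 \<le> N_o \<sigma> T B \<delta>"
  using T B \<delta> by (simp add: N_o_def)

text \<open>Solving 4 ln (2/\<delta>) \<le> c for N, with c the common factor in the exponents of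
  \<open>f\<close>, gives the bound. It is uniform in \<alpha>, so it serves both
  \<open>N_of\<close> and \<open>N_tilde\<close>.\<close>

lemma N_o_le_of_f_le:
  assumes N: "0 \<le> N" and a: "\<alpha> \<in> {0<..<1}" and le: "f \<sigma> T B N \<alpha> \<le> \<delta>"
  shows "N_o \<sigma> T B \<delta> \<le> N"
proof -
  have "4 * ln (2 / \<delta>) \<le> N\<^sup>2 * B\<^sup>2 / (2 * \<sigma>\<^sup>2 * T)"
    using a \<delta> le by (intro gaussian_sum_le_imp[of \<alpha>]) (auto simp: f_def)
  then have "8 * \<sigma>\<^sup>2 * T * ln (2 / \<delta>) \<le> (N * B)\<^sup>2"
    using \<sigma> T by (simp add: field_simps power_mult_distrib)
  then have "sqrt (8 * \<sigma>\<^sup>2 * T * ln (2 / \<delta>)) \<le> N * B"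
    using N B by (intro real_le_lsqrt) auto
  then show ?thesis
    using B by (simp add: N_o_def pos_divide_le_eq)
qed

lemma f_N_o: "f \<sigma> T B (N_o \<sigma> T B \<delta>) (1/2) = \<delta>"
proof -
  \<comment> \<open>Nonnegativity of the radicand lets the square undo the root in
    \<open>N_o\<close>.\<close>
  have "0 \<le> ln (2 / \<delta>)" using \<delta> by simp
  then have "(N_o \<sigma> T B \<delta>)\<^sup>2 * B\<^sup>2 / (8 * \<sigma>\<^sup>2 * T) = ln (2 / \<delta>)"
    using \<sigma> T B by (simp add: N_o_def power_divide)
  then have "f \<sigma> T B (N_o \<sigma> T B \<delta>) (1/2) = 2 * exp (- ln (2 / \<delta>))"
    by (simp add: f_half)
  also have "\<dots> = \<delta>"
    using \<delta> by (simp add: exp_minus)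
  finally show ?thesis .
qed

lemma is_minimum_N_o_half: "is_minimum (feasible \<sigma> T B \<delta> (1/2)) (N_o \<sigma> T B \<delta>)"
  using f_N_o N_o_nonneg N_o_le_of_f_le[of _ "1/2"]
  by (auto simp: is_minimum_def feasible_def)

lemma is_minimum_N_o_any: "is_minimum (feasible_any \<sigma> T B \<delta>) (N_o \<sigma> T B \<delta>)"
  using f_N_o N_o_nonneg N_o_le_of_f_le
  by (auto simp: is_minimum_def feasible_any_def intro!: bexI[of _ "1/2"])

text \<open>Both \<alpha> and 1 - \<alpha> are nonzero, so both exponentials tend to 0 as N grows
  and \<open>f\<close> eventually drops below \<delta>.\<close>

lemma feasible_nonempty:
  assumes a: "\<alpha> \<in> {0<..<1}"
  shows "feasible \<sigma> T B \<delta> \<alpha> \<noteq> {}"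
proof -
  have tend: "((\<lambda>N. exp (- (N\<^sup>2 * B\<^sup>2 * b\<^sup>2 / (2 * \<sigma>\<^sup>2 * T)))) \<longlongrightarrow> 0) at_top" if "b \<noteq> 0" for b
  proof -
    have "0 < B\<^sup>2 * b\<^sup>2 / (2 * \<sigma>\<^sup>2 * T)"
      using that \<sigma> T B by simp
    then have "filterlim (\<lambda>N. B\<^sup>2 * b\<^sup>2 / (2 * \<sigma>\<^sup>2 * T) * N\<^sup>2) at_top at_top"
      by (intro filterlim_tendsto_pos_mult_at_top[OF tendsto_const]
          filterlim_pow_at_top filterlim_ident) auto
    then have "filterlim (\<lambda>N. - (B\<^sup>2 * b\<^sup>2 / (2 * \<sigma>\<^sup>2 * T) * N\<^sup>2)) at_bot at_top"
      by (simp add: filterlim_uminus_at_bot)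
    from filterlim_compose[OF exp_at_bot this] show ?thesis
      by (simp add: mult_ac)
  qed
  have "((\<lambda>N. f \<sigma> T B N \<alpha>) \<longlongrightarrow> 0 + 0) at_top"
    unfolding f_def using a by (intro tendsto_add tend) auto
  then have "eventually (\<lambda>N. f \<sigma> T B N \<alpha> < \<delta>) at_top"
    using \<delta> by (intro order_tendstoD(2)) auto
  then have "eventually (\<lambda>N. N \<in> feasible \<sigma> T B \<delta> \<alpha>) at_top"
    using eventually_ge_at_top[of 0] by eventually_elim (simp add: feasible_def)
  then show ?thesis
    using eventually_happens by fastforce
qed

text \<open>A nonempty closed set of reals that is bounded below contains its infimum, and
  \<open>LEAST\<close> then picks out that infimum.\<close>

lemma is_minimum_N_of:
  assumes "\<alpha> \<in> {0<..<1}"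
  shows "is_minimum (feasible \<sigma> T B \<delta> \<alpha>) (N_of \<sigma> T B \<delta> \<alpha>)"
proof -
  let ?S = "feasible \<sigma> T B \<delta> \<alpha>"
  have "closed ?S"
    \<comment> \<open>With quotients written as products, the denominator becomes a constant factor,
      so continuity raises no side condition that it be nonzero.\<close>
    unfolding feasible_def f_def divide_inverse
    by (intro closed_Collect_conj closed_Collect_le continuous_intros)
  moreover have bdd: "bdd_below ?S"
    by (auto simp: feasible_def intro!: bdd_belowI[of _ 0])
  ultimately have "is_minimum ?S (Inf ?S)"
    using feasible_nonempty[OF assms]
    by (auto simp: is_minimum_def intro: closed_contains_Inf cInf_lower)
  then show ?thesis
    unfolding N_of_def by (simp add: is_minimum_Least)
qed

lemma N_o_le_N_of:
  assumes "\<alpha> \<in> {0<..<1}"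
  shows "N_o \<sigma> T B \<delta> \<le> N_of \<sigma> T B \<delta> \<alpha>"
  using is_minimum_N_of[OF assms] N_o_le_of_f_le[OF _ assms]
  by (simp add: is_minimum_def feasible_def)

lemma N_of_half: "N_of \<sigma> T B \<delta> (1/2) = N_o \<sigma> T B \<delta>"
  unfolding N_of_def by (rule is_minimum_Least[OF is_minimum_N_o_half])

lemma N_tilde_eq: "N_tilde \<sigma> T B \<delta> = N_o \<sigma> T B \<delta>"
  unfolding N_tilde_def by (rule is_minimum_Least[OF is_minimum_N_o_any])

text \<open>Needed for the second description of \<open>N_tilde\<close>, as the least of all
  N(\<alpha>): the value at 1/2 is \<open>N_o\<close>, which bounds every other value from
  below.\<close>

lemma is_minimum_image_N_of:
  "is_minimum (N_of \<sigma> T B \<delta> ` {0<..<1}) (N_o \<sigma> T B \<delta>)"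
  unfolding is_minimum_def
proof
  show "N_o \<sigma> T B \<delta> \<in> N_of \<sigma> T B \<delta> ` {0<..<1}"
    by (rule image_eqI[of _ _ "1/2"]) (simp_all only: N_of_half, simp)
  show "\<forall>x\<in>N_of \<sigma> T B \<delta> ` {0<..<1}. N_o \<sigma> T B \<delta> \<le> x"
    using N_o_le_N_of by blast
qed

end

theorem theorem1:
  fixes \<sigma> T\<^sub>f B\<^sub>m\<^sub>a\<^sub>x \<delta> :: real
  assumes "\<sigma> \<noteq> 0" and "T\<^sub>f > 0" and "B\<^sub>m\<^sub>a\<^sub>x > 0" and "0 < \<delta>" and "\<delta> < 1"
  shows "(\<forall>\<alpha>\<in>{0<..<1}. is_minimum (feasible \<sigma> T\<^sub>f B\<^sub>m\<^sub>a\<^sub>x \<delta> \<alpha>) (N_of \<sigma> T\<^sub>f B\<^sub>m\<^sub>a\<^sub>x \<delta> \<alpha>))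
    \<and> is_minimum (feasible_any \<sigma> T\<^sub>f B\<^sub>m\<^sub>a\<^sub>x \<delta>) (N_tilde \<sigma> T\<^sub>f B\<^sub>m\<^sub>a\<^sub>x \<delta>)
    \<and> is_minimum (N_of \<sigma> T\<^sub>f B\<^sub>m\<^sub>a\<^sub>x \<delta> ` {0<..<1}) (N_tilde \<sigma> T\<^sub>f B\<^sub>m\<^sub>a\<^sub>x \<delta>)
    \<and> N_of \<sigma> T\<^sub>f B\<^sub>m\<^sub>a\<^sub>x \<delta> (1/2) = N_o \<sigma> T\<^sub>f B\<^sub>m\<^sub>a\<^sub>x \<delta>
    \<and> (\<forall>\<alpha>\<in>{0<..<1} - {1/2}. N_of \<sigma> T\<^sub>f B\<^sub>m\<^sub>a\<^sub>x \<delta> (1/2) \<le> N_of \<sigma> T\<^sub>f B\<^sub>m\<^sub>a\<^sub>x \<delta> \<alpha>)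
    \<and> N_tilde \<sigma> T\<^sub>f B\<^sub>m\<^sub>a\<^sub>x \<delta> = N_of \<sigma> T\<^sub>f B\<^sub>m\<^sub>a\<^sub>x \<delta> (1/2)
    \<and> N_tilde \<sigma> T\<^sub>f B\<^sub>m\<^sub>a\<^sub>x \<delta> = N_o \<sigma> T\<^sub>f B\<^sub>m\<^sub>a\<^sub>x \<delta>"
  using is_minimum_N_of[OF assms] is_minimum_N_o_any[OF assms] is_minimum_image_N_of[OF assms]
    N_of_half[OF assms] N_tilde_eq[OF assms] N_o_le_N_of[OF assms]
  by (simp only: DiffD1 simp_thms ball_simps) blast

end
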